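(* For all integers $n,k\ge0$ we have \[ \mathrm{ac}_+^k(n) = \sum_{2r+i+j=n-2k} 2^i\binom{r+k}{k}\binom{r}{i}\binom{i+j-1}{j} = \sum_{i+j+r+2s=n-2k} (-1)^i\binom{k+1}{i}\binom{j+k}{j}\binom{j}{r+s}\binom{r+s}{r}. \]
   Context: A composition of $n$ is a finite sequence $\alpha=(\alpha_1,\ldots,\alpha_\ell)$ of positive integers with $\alpha_1+\cdots+\alpha_\ell=n$; the empty sequence ($\ell=0$) is the only composition of $0$. $\mathrm{ac}_+^k(n)$ is the number of compositions $\alpha=(\alpha_1,\ldots,\alpha_\ell)$ of $n$ such that $\#\{1\le i\le \ell/2:\alpha_i=\alpha_{\ell+1-i}\}=k$ and either $\ell$ is even, or $\ell$ is odd and the middle part $\alpha_{(\ell+1)/2}$ is even. Convention for binomial coefficients, for integers $a,b$: $\binom{a}{b}=\frac{a!}{b!(a-b)!}$ if $a\ge b\ge1$; $\binom{a}{b}=1$ if $b=0$ (for every integer $a$, including $a=-1$); $\binom{a}{b}=0$ otherwise. Summation indices range over nonnegative integers. *)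

theory Defs
  imports Complex_Main
begin

definition compositions :: "nat \<Rightarrow> nat list set" where
  "compositions n = {\<alpha>. (\<forall>a\<in>set \<alpha>. a \<ge> 1) \<and> sum_list \<alpha> = n}"

(* 1-based access, so that part alpha i is the i-th part for 1 <= i <= length alpha *)
definition part :: "nat list \<Rightarrow> nat \<Rightarrow> nat" where
  "part \<alpha> i = \<alpha> ! (i - 1)"

(* On nat, i <= l div 2 is the same as i <= l/2. *)
definition sym_pairs :: "nat list \<Rightarrow> nat" where
  "sym_pairs \<alpha> =
     card {i. 1 \<le> i \<and> i \<le> length \<alpha> div 2 \<and> part \<alpha> i = part \<alpha> (length \<alpha> + 1 - i)}"

definition ac_plus :: "nat \<Rightarrow> nat \<Rightarrow> nat" where
  "ac_plus k n =
     card {\<alpha> \<in> compositions n. sym_pairs \<alpha> = k \<and>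
             (even (length \<alpha>) \<or> odd (length \<alpha>) \<and> even (part \<alpha> ((length \<alpha> + 1) div 2)))}"

(* Binomial coefficient of two integers, equal to 1 at b = 0 for every a (including a = -1)
   and to 0 outside a >= b >= 0; it differs from gchoose for negative a. *)
definition ibinom :: "int \<Rightarrow> int \<Rightarrow> int" where
  "ibinom a b = (if b = 0 then 1
                 else if a \<ge> b \<and> b \<ge> 1 then int (nat a choose nat b)
                 else 0)"

end

theory Submission
  imports Defs "HOL-Computational_Algebra.Formal_Power_Series"
begin

text \<open>
  Let $P_k = \sum_n ac_+^k(n) x^n$. A composition with at least two parts is an outer pair
  $(a, b)$ wrapped around a shorter composition; wrapping keeps the middle part and adds a symmetric
  pair exactly when $a = b$. Let $E$ and $U$ be the generating functions of the pairs with equal and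
  with different entries. The only compositions left are the empty one and those with a single even
  part, with generating function $1/(1-x^2)$. Hence
  \[ P_0 (1 - U) = 1/(1-x^2), \qquad P_{k+1} (1 - U) = E P_k . \]
  Here $E = x^2/(1-x^2)$ and $E + U = (x/(1-x))^2$, so that
  $(1 - x^2)(1 - U) = 1 - Y$ with $Y = x^2 (1 + 2x/(1-x))$ and
  \[ P_k = x^{2k} / (1 - Y)^{k+1} \]
  (lemma \<open>gf_comps_mult\<close>). On the other hand $(1-x)(1-Y) = 1 - x - x^2 - x^3$, so with
  $T = x (1 + x (1 + x))$ also $P_k = x^{2k} (1-x)^{k+1} / (1 - T)^{k+1}$ (lemma
  \<open>two_closed_forms\<close>).

  The two sums of the theorem are the coefficients of these two expressions, expanded with
  $1/(1-z)^{k+1} = \sum_r {r+k \choose k} z^r$ and the binomial theorem. Each such expansion at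
  $z = x^p Q$ substitutes $x^p Q$ into a known series, and \<open>fps_compose_eq_gf\<close> turns such a
  substitution into a sum over one more index.

  All series have integer coefficients. Quotients are avoided: a series such as
  $1/(1-x)$ is given by its coefficients and used through the equation $Z (1 - x) = 1$.
\<close>

unbundle fps_syntax

section \<open>Weighted generating functions\<close>

definition finite_grading :: "('a \<Rightarrow> nat) \<Rightarrow> 'a set \<Rightarrow> bool" where
  "finite_grading w A \<longleftrightarrow> (\<forall>n. finite {x \<in> A. w x \<le> n})"

text \<open>
  The formal sum of $c(x) X^{w(x)}$ over $x \in A$. With $c = 1$ it counts the elements of $A$
  by weight; with products of binomial coefficients as $c$, on tuples of indices, its coefficients are
  the multiple sums of the theorem. Only under \<open>finite_grading w A\<close> are all coefficients
  genuine finite sums.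
\<close>
definition gf :: "('a \<Rightarrow> int) \<Rightarrow> ('a \<Rightarrow> nat) \<Rightarrow> 'a set \<Rightarrow> int fps" where
  "gf c w A = Abs_fps (\<lambda>n. \<Sum>x | x \<in> A \<and> w x = n. c x)"

abbreviation counting_gf :: "('a \<Rightarrow> nat) \<Rightarrow> 'a set \<Rightarrow> int fps" where
  "counting_gf \<equiv> gf (\<lambda>_. 1)"

lemma gf_nth: "gf c w A $ n = (\<Sum>x | x \<in> A \<and> w x = n. c x)"
  by (simp add: gf_def)

lemma counting_gf_nth: "counting_gf w A $ n = int (card {x \<in> A. w x = n})"
  by (simp add: gf_nth)

lemma finite_gradingD: "finite_grading w A \<Longrightarrow> finite {x \<in> A. w x \<le> n}"
  by (simp add: finite_grading_def)

lemma finite_grading_fibre: "finite_grading w A \<Longrightarrow> finite {x \<in> A. w x = n}"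
  by (rule finite_subset[OF _ finite_gradingD[of w A n]]) auto

lemma finite_grading_subset:
  assumes "finite_grading w B" "A \<subseteq> B"
  shows "finite_grading w A"
  unfolding finite_grading_def
proof
  fix n
  show "finite {x \<in> A. w x \<le> n}"
    by (rule finite_subset[OF _ finite_gradingD[OF assms(1), of n]]) (use assms(2) in auto)
qed

lemma finite_grading_nat:
  fixes w :: "nat \<Rightarrow> nat"
  assumes "\<And>i. i \<le> w i"
  shows "finite_grading w A"
  unfolding finite_grading_def
proof
  fix n
  have "{x \<in> A. w x \<le> n} \<subseteq> {..n}"
    using assms le_trans by fastforce
  then show "finite {x \<in> A. w x \<le> n}"
    by (rule finite_subset) simp
qed

lemma finite_grading_Sigma:
  assumes "finite_grading w A" "\<And>x. x \<in> A \<Longrightarrow> finite_grading (v x) (B x)"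
  shows "finite_grading (\<lambda>(x, y). w x + v x y) (Sigma A B)"
  unfolding finite_grading_def
proof
  fix n
  have "{p \<in> Sigma A B. (case p of (x, y) \<Rightarrow> w x + v x y) \<le> n}
      \<subseteq> Sigma {x \<in> A. w x \<le> n} (\<lambda>x. {y \<in> B x. v x y \<le> n})"
    by auto
  then show "finite {p \<in> Sigma A B. (case p of (x, y) \<Rightarrow> w x + v x y) \<le> n}"
    by (rule finite_subset) (auto intro!: finite_SigmaI assms finite_gradingD)
qed

lemma gf_Un:
  assumes "finite_grading w A" "finite_grading w B" "A \<inter> B = {}"
  shows "gf c w (A \<union> B) = gf c w A + gf c w B"
proof (rule fps_ext)
  fix n
  have "{x. x \<in> A \<union> B \<and> w x = n} = {x \<in> A. w x = n} \<union> {x \<in> B. w x = n}"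
    by auto
  then show "gf c w (A \<union> B) $ n = (gf c w A + gf c w B) $ n"
    using assms by (auto simp: gf_nth intro!: sum.union_disjoint finite_grading_fibre)
qed

lemma gf_mono_neutral:
  assumes "finite_grading w A" "B \<subseteq> A" "\<And>x. x \<in> A - B \<Longrightarrow> c x = 0"
  shows "gf c w A = gf c w B"
  using assms
  by (intro fps_ext) (auto simp: gf_nth intro!: sum.mono_neutral_right finite_grading_fibre)

lemma gf_image:
  assumes "inj_on f A"
  shows "gf c w (f ` A) = gf (\<lambda>x. c (f x)) (\<lambda>x. w (f x)) A"
proof (rule fps_ext)
  fix n
  have "{x. x \<in> f ` A \<and> w x = n} = f ` {x. x \<in> A \<and> w (f x) = n}"
    by auto
  moreover have "inj_on f {x. x \<in> A \<and> w (f x) = n}"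
    using assms by (rule inj_on_subset) auto
  ultimately show "gf c w (f ` A) $ n = gf (\<lambda>x. c (f x)) (\<lambda>x. w (f x)) A $ n"
    by (simp add: gf_nth sum.reindex)
qed

text \<open>
  Summing over $y$ for each fixed $x$. The inner data may depend on $x$, which the product
  rule below does not allow but the composition rule needs.
\<close>
lemma gf_Sigma_nth:
  assumes "finite_grading w A" "\<And>x. x \<in> A \<Longrightarrow> finite_grading (v x) (B x)"
  shows "gf (\<lambda>(x, y). c x * d x y) (\<lambda>(x, y). w x + v x y) (Sigma A B) $ n
       = (\<Sum>x | x \<in> A \<and> w x \<le> n. c x * gf (d x) (v x) (B x) $ (n - w x))"
proof -
  have "{p. p \<in> Sigma A B \<and> (case p of (x, y) \<Rightarrow> w x + v x y) = n}
      = Sigma {x \<in> A. w x \<le> n} (\<lambda>x. {y \<in> B x. v x y = n - w x})"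
    by auto
  then show ?thesis
    using assms
    by (simp add: gf_nth sum.Sigma[symmetric] finite_gradingD finite_grading_fibre sum_distrib_left)
qed

lemma gf_mult:
  assumes "finite_grading w A" "finite_grading v B"
  shows "gf c w A * gf d v B = gf (\<lambda>(x, y). c x * d y) (\<lambda>(x, y). w x + v y) (A \<times> B)"
proof (rule fps_ext)
  fix n
  let ?S = "{x \<in> A. w x \<le> n}"
  have "(gf c w A * gf d v B) $ n
      = (\<Sum>m = 0..n. \<Sum>x | x \<in> ?S \<and> w x = m. c x * gf d v B $ (n - w x))"
    by (auto simp: fps_mult_nth gf_nth[of c] sum_distrib_right intro!: sum.cong)
  also have "\<dots> = (\<Sum>x\<in>?S. c x * gf d v B $ (n - w x))"
    by (rule sum.group) (auto intro: finite_gradingD assms)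
  also have "\<dots> = gf (\<lambda>(x, y). c x * d y) (\<lambda>(x, y). w x + v y) (A \<times> B) $ n"
    using assms by (subst gf_Sigma_nth) auto
  finally show "(gf c w A * gf d v B) $ n = \<dots>" .
qed

text \<open>
  $F \circ (X^p T) = \sum_r F_r X^{pr} T^r$. If each power of $T$ is a sum over indices $y$, the
  composite is a sum over pairs $(r, y)$. The condition $p \geq 1$ makes the substitution
  legitimate: for each degree only finitely many $r$ contribute.
\<close>
lemma fps_compose_eq_gf:
  fixes F T :: "int fps"
  assumes "p \<ge> 1"
    and "\<And>r. T ^ r = gf (d r) (v r) UNIV"
    and "\<And>r. finite_grading (v r) UNIV"
  shows "F oo (fps_X ^ p * T) = gf (\<lambda>(r, y). F $ r * d r y) (\<lambda>(r, y). p * r + v r y) UNIV"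
proof (rule fps_ext)
  fix m
  have le: "r \<le> p * r" for r
    using assms(1) by (cases p) auto
  have "(F oo (fps_X ^ p * T)) $ m = (\<Sum>r = 0..m. F $ r * (if m < p * r then 0 else T ^ r $ (m - p * r)))"
    by (simp add: fps_compose_nth power_mult_distrib power_mult[symmetric] fps_X_power_mult_nth)
  also have "\<dots> = (\<Sum>r | p * r \<le> m. F $ r * T ^ r $ (m - p * r))"
    using le by (intro sum.mono_neutral_cong_right) (auto intro: le_trans[OF le])
  also have "\<dots> = gf (\<lambda>(r, y). F $ r * d r y) (\<lambda>(r, y). p * r + v r y) (Sigma UNIV (\<lambda>_. UNIV)) $ m"
    using assms le by (subst gf_Sigma_nth) (auto intro: finite_grading_nat)
  finally show "(F oo (fps_X ^ p * T)) $ m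
      = gf (\<lambda>(r, y). F $ r * d r y) (\<lambda>(r, y). p * r + v r y) UNIV $ m"
    by simp
qed

section \<open>Binomial series\<close>

lemma ibinom_of_nat: "ibinom (int a) (int b) = int (a choose b)"
  by (auto simp: ibinom_def binomial_eq_0)

lemma linear_power_nth: "(1 + fps_const c * fps_X) ^ m $ i = c ^ i * int (m choose i)"
proof (induction m arbitrary: i)
  case 0
  then show ?case by (cases i) auto
next
  case (Suc m)
  then show ?case
    by (cases i) (simp_all add: algebra_simps)
qed

text \<open>
  The series $(1 - X)^{-(k+1)}$. The case $k = 0$ is the geometric series $1/(1 - X)$.
\<close>
definition neg_binomial_series :: "nat \<Rightarrow> int fps" where
  "neg_binomial_series k = Abs_fps (\<lambda>r. int ((r + k) choose k))"

lemma neg_binomial_series_nth [simp]: "neg_binomial_series k $ r = int ((r + k) choose k)"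
  by (simp add: neg_binomial_series_def)

lemma neg_binomial_series_0_mult: "neg_binomial_series 0 * (1 - fps_X) = 1"
  by (rule fps_ext) (simp add: algebra_simps)

text \<open>
  Multiplication by $1 - X$ takes differences of coefficients, and Pascal's rule evaluates them.
\<close>
lemma neg_binomial_series_Suc_mult:
  "neg_binomial_series (Suc k) * (1 - fps_X) = neg_binomial_series k"
proof (rule fps_ext)
  fix n
  show "(neg_binomial_series (Suc k) * (1 - fps_X)) $ n = neg_binomial_series k $ n"
    by (cases n) (simp_all add: algebra_simps)
qed

lemma neg_binomial_series_mult: "neg_binomial_series k * (1 - fps_X) ^ Suc k = 1"
proof (induction k)
  case 0
  then show ?case by (simp add: neg_binomial_series_0_mult)
next
  case (Suc k)
  have "neg_binomial_series (Suc k) * (1 - fps_X) ^ Suc (Suc k)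
      = (neg_binomial_series (Suc k) * (1 - fps_X)) * (1 - fps_X) ^ Suc k"
    by (simp add: algebra_simps)
  with Suc show ?case
    by (simp add: neg_binomial_series_Suc_mult)
qed

lemma neg_binomial_series_compose:
  assumes "Y $ 0 = 0"
  shows "(neg_binomial_series k oo Y) * (1 - Y) ^ Suc k = 1"
proof -
  have "(neg_binomial_series k * (1 - fps_X) ^ Suc k) oo Y
      = (neg_binomial_series k oo Y) * ((1 - fps_X) ^ Suc k oo Y)"
    by (rule fps_compose_mult_distrib[OF assms])
  also have "(1 - fps_X) ^ Suc k oo Y = (1 - Y) ^ Suc k"
    by (simp only: fps_compose_power[OF assms, symmetric] fps_compose_sub_distrib fps_compose_1
        fps_X_fps_compose_startby0[OF assms])
  finally show ?thesis
    by (simp only: neg_binomial_series_mult fps_compose_1)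
qed

text \<open>
  The binomial theorem for $1 + X Q$, read as the substitution of $X Q$ into $(1 + X)^r$ so that
  powers of $Q$ given as indexed sums can be inserted. The index $i$ runs over all naturals, since
  ${r \choose i} = 0$ for $i > r$.
\<close>
lemma linear_power_compose:
  fixes Q :: "int fps"
  assumes "\<And>i. Q ^ i = gf (d i) (v i) UNIV" "\<And>i. finite_grading (v i) UNIV"
  shows "(1 + fps_X * Q) ^ r
       = gf (\<lambda>(i, y). int (r choose i) * d i y) (\<lambda>(i, y). i + v i y) UNIV"
proof -
  have 0: "(fps_X * Q) $ 0 = 0" by simp
  have "(1 + fps_X) ^ r oo (fps_X ^ 1 * Q)
      = gf (\<lambda>(i, y). (1 + fps_X) ^ r $ i * d i y) (\<lambda>(i, y). 1 * i + v i y) UNIV"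
    by (rule fps_compose_eq_gf) (use assms in auto)
  moreover have "(1 + fps_X) ^ r oo (fps_X * Q) = (1 + fps_X * Q) ^ r"
    by (simp only: fps_compose_power[OF 0, symmetric] fps_compose_add_distrib fps_compose_1
        fps_X_fps_compose_startby0[OF 0])
  moreover have "(1 + fps_X :: int fps) ^ r $ i = int (r choose i)" for i
    using linear_power_nth[of 1 r i] by simp
  ultimately show ?thesis
    by simp
qed

lemma fps_eq_gf_nat: "F = gf (\<lambda>i. F $ i) (\<lambda>i. i) UNIV"
  by (rule fps_ext) (simp add: gf_nth)

text \<open>
  For $i \geq 1$ this is the negative binomial series with $k = i - 1$. For $i = 0$ the power
  is $1$, and this is what the convention ${-1 \choose 0} = 1$ encodes.
\<close>
lemma geometric_power_nth:
  "neg_binomial_series 0 ^ i $ j = ibinom (int i + int j - 1) (int j)"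
proof (cases i)
  case 0
  then show ?thesis by (auto simp: ibinom_def)
next
  case (Suc k)
  have "neg_binomial_series k = neg_binomial_series 0 ^ Suc k"
  proof -
    have "neg_binomial_series k * ((1 - fps_X) ^ Suc k * neg_binomial_series 0 ^ Suc k)
        = neg_binomial_series 0 ^ Suc k"
      by (simp only: mult.assoc[symmetric] neg_binomial_series_mult mult_1_left)
    moreover have "(1 - fps_X) ^ Suc k * neg_binomial_series 0 ^ Suc k = 1"
      by (metis neg_binomial_series_0_mult mult.commute power_mult_distrib power_one)
    ultimately show ?thesis by (simp only: mult_1_right)
  qed
  moreover have "int (Suc k) + int j - 1 = int (j + k)" by simp
  ultimately show ?thesis
    using Suc ibinom_of_nat[of "j + k" j] binomial_symmetric[of k "j + k"]
    by (metis add_diff_cancel_right' le_add2 neg_binomial_series_nth)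
qed

section \<open>Counting compositions\<close>

lemma sym_pairs_Nil [simp]: "sym_pairs [] = 0"
  by (simp add: sym_pairs_def)

lemma sym_pairs_single [simp]: "sym_pairs [a] = 0"
  by (simp add: sym_pairs_def)

text \<open>
  Position $1$ compares $a$ with $b$, and position $i + 1$ of the longer list
  compares the same two parts as position $i$ of $\beta$.
\<close>
lemma sym_pairs_wrap:
  "sym_pairs (a # \<beta> @ [b]) = (if a = b then 1 else 0) + sym_pairs \<beta>"
proof -
  let ?\<alpha> = "a # \<beta> @ [b]"
  let ?I = "\<lambda>\<gamma>. {i. 1 \<le> i \<and> i \<le> length \<gamma> div 2 \<and> part \<gamma> i = part \<gamma> (length \<gamma> + 1 - i)}"
  have inner: "part ?\<alpha> (Suc i) = part \<beta> i \<and>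
      part ?\<alpha> (length ?\<alpha> + 1 - Suc i) = part \<beta> (length \<beta> + 1 - i)"
    if "1 \<le> i" "i \<le> length \<beta> div 2" for i
  proof -
    (* Both positions lie strictly inside the list, so neither lookup hits a or b. *)
    from that(1) obtain i' where i': "i = Suc i'" by (cases i) auto
    with that(2) have lt: "i' < length \<beta>" by linarith
    then obtain m where m: "length \<beta> - i' = Suc m" "m < length \<beta>"
      by (cases "length \<beta> - i'") auto
    have "length ?\<alpha> + 1 - Suc i = Suc (Suc m)" "length \<beta> + 1 - i = Suc m"
      using m i' by auto
    with i' lt m show ?thesis
      by (simp add: Defs.part_def nth_append)
  qed
  have outer: "part ?\<alpha> 1 = a" "part ?\<alpha> (length ?\<alpha>) = b"
    by (simp_all add: Defs.part_def nth_append)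
  have eq: "?I ?\<alpha> = (if a = b then {1} else {}) \<union> Suc ` ?I \<beta>" (is "_ = ?R")
  proof (rule set_eqI)
    fix i
    show "i \<in> ?I ?\<alpha> \<longleftrightarrow> i \<in> ?R"
    proof (cases "i \<le> 1")
      case True
      then consider "i = 0" | "i = 1" by linarith
      then show ?thesis
        using outer by cases auto
    next
      case False
      then obtain i' where i': "i = Suc i'" "1 \<le> i'" by (cases i) auto
      show ?thesis
      proof (cases "i' \<le> length \<beta> div 2")
        case True
        then show ?thesis using i' inner[of i'] by (auto simp: image_iff)
      next
        case False
        then show ?thesis using i' by (auto simp: image_iff)
      qed
    qed
  qed
  have fin: "finite (?I \<beta>)"
    by (rule finite_subset[of _ "{..length \<beta> div 2}"]) auto
  have "card (?I ?\<alpha>) = card (if a = b then {1::nat} else {}) + card (Suc ` ?I \<beta>)"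
    unfolding eq by (rule card_Un_disjoint) (use fin in auto)
  then show ?thesis
    by (auto simp: sym_pairs_def card_image)
qed

definition mid_even :: "nat list \<Rightarrow> bool" where
  "mid_even \<alpha> \<longleftrightarrow> even (length \<alpha>) \<or> even (part \<alpha> ((length \<alpha> + 1) div 2))"

lemma mid_even_Nil [simp]: "mid_even []"
  by (simp add: mid_even_def)

lemma mid_even_single [simp]: "mid_even [a] \<longleftrightarrow> even a"
  by (simp add: mid_even_def Defs.part_def)

lemma mid_even_wrap [simp]: "mid_even (a # \<beta> @ [b]) = mid_even \<beta>"
proof (cases "even (length \<beta>)")
  case True
  then show ?thesis by (simp add: mid_even_def)
next
  case False
  then obtain m where "length \<beta> = 2 * m + 1" by (auto elim: oddE)
  then show ?thesis
    by (simp add: mid_even_def Defs.part_def nth_append)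
qed

definition mid_even_comps :: "nat \<Rightarrow> nat list set" where
  "mid_even_comps k = {\<alpha>. (\<forall>a\<in>set \<alpha>. a \<ge> 1) \<and> sym_pairs \<alpha> = k \<and> mid_even \<alpha>}"

lemma ac_plus_eq_nth: "int (ac_plus k n) = counting_gf sum_list (mid_even_comps k) $ n"
  unfolding ac_plus_def counting_gf_nth compositions_def mid_even_comps_def mid_even_def
  by (rule arg_cong[where f = "\<lambda>S. int (card S)"]) auto

lemma finite_grading_sum_list:
  "finite_grading sum_list {\<alpha> :: nat list. \<forall>a\<in>set \<alpha>. a \<ge> 1}"
  unfolding finite_grading_def
proof
  fix n
  have "length \<alpha> \<le> sum_list \<alpha>" if "\<forall>a\<in>set \<alpha>. a \<ge> 1" for \<alpha> :: "nat list"
    using that by (induction \<alpha>) auto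
  moreover have "a \<le> sum_list \<alpha>" if "a \<in> set \<alpha>" for a :: nat and \<alpha>
    using that by (simp add: member_le_sum_list)
  ultimately have "{\<alpha> \<in> {\<alpha> :: nat list. \<forall>a\<in>set \<alpha>. a \<ge> 1}. sum_list \<alpha> \<le> n}
      \<subseteq> {\<alpha>. set \<alpha> \<subseteq> {..n} \<and> length \<alpha> \<le> n}"
    by (auto dest: order.trans)
  then show "finite {\<alpha> \<in> {\<alpha> :: nat list. \<forall>a\<in>set \<alpha>. a \<ge> 1}. sum_list \<alpha> \<le> n}"
    by (rule finite_subset) (rule finite_lists_length_le, simp)
qed

lemma finite_grading_mid_even_comps: "finite_grading sum_list (mid_even_comps k)"
  by (rule finite_grading_subset[OF finite_grading_sum_list]) (auto simp: mid_even_comps_def)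

definition wrap :: "(nat \<times> nat) \<times> nat list \<Rightarrow> nat list" where
  "wrap = (\<lambda>((a, b), \<beta>). a # \<beta> @ [b])"

lemma inj_wrap: "inj_on wrap A"
  by (auto simp: inj_on_def wrap_def)

definition equal_pairs :: "(nat \<times> nat) set" where
  "equal_pairs = {(a, b). a \<ge> 1 \<and> b = a}"

definition unequal_pairs :: "(nat \<times> nat) set" where
  "unequal_pairs = {(a, b). a \<ge> 1 \<and> b \<ge> 1 \<and> a \<noteq> b}"

definition short_comps :: "nat list set" where
  "short_comps = {\<alpha> \<in> mid_even_comps 0. length \<alpha> \<le> 1}"

lemma list_wrap_cases:
  obtains "\<alpha> = []" | a where "\<alpha> = [a]" | a b \<beta> where "\<alpha> = wrap ((a, b), \<beta>)"
proof (cases \<alpha>)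
  case Nil
  then show ?thesis using that by simp
next
  case (Cons a \<gamma>)
  then show ?thesis
    using that by (cases \<gamma> rule: rev_cases) (auto simp: wrap_def)
qed

lemma wrap_in_mid_even_comps:
  "wrap ((a, b), \<beta>) \<in> mid_even_comps k \<longleftrightarrow>
     (a, b) \<in> unequal_pairs \<and> \<beta> \<in> mid_even_comps k \<or>
     (a, b) \<in> equal_pairs \<and> (\<exists>k'. k = Suc k' \<and> \<beta> \<in> mid_even_comps k')"
  by (auto simp: mid_even_comps_def wrap_def equal_pairs_def unequal_pairs_def sym_pairs_wrap)

lemma wrap_not_short [simp]:
  "wrap x \<noteq> []" "[] \<noteq> wrap x" "wrap x \<noteq> [a]" "[a] \<noteq> wrap x" "\<not> length (wrap x) \<le> Suc 0"
  by (auto simp: wrap_def split: prod.splits)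

text \<open>
  Peeling off the outer pair. Without symmetric pairs the outer pair is unequal.
\<close>
lemma mid_even_comps_0: "mid_even_comps 0 = short_comps \<union> wrap ` (unequal_pairs \<times> mid_even_comps 0)"
proof (rule set_eqI)
  fix \<alpha>
  show "\<alpha> \<in> mid_even_comps 0 \<longleftrightarrow> \<alpha> \<in> short_comps \<union> wrap ` (unequal_pairs \<times> mid_even_comps 0)"
  proof (cases \<alpha> rule: list_wrap_cases)
    case (3 a b \<beta>)
    then show ?thesis
      by (auto simp: wrap_in_mid_even_comps inj_image_mem_iff[OF inj_wrap] short_comps_def)
  qed (auto simp: short_comps_def)
qed

text \<open>
  A composition with a symmetric pair has at least two parts, so no short one occurs. If its outer
  pair is equal, that pair accounts for one of the $k + 1$ symmetric pairs; otherwise all of them lie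
  inside.
\<close>
lemma mid_even_comps_Suc:
  "mid_even_comps (Suc k) = wrap ` (equal_pairs \<times> mid_even_comps k)
      \<union> wrap ` (unequal_pairs \<times> mid_even_comps (Suc k))"
proof (rule set_eqI)
  fix \<alpha>
  show "\<alpha> \<in> mid_even_comps (Suc k) \<longleftrightarrow> \<alpha> \<in> wrap ` (equal_pairs \<times> mid_even_comps k)
      \<union> wrap ` (unequal_pairs \<times> mid_even_comps (Suc k))"
  proof (cases \<alpha> rule: list_wrap_cases)
    case (3 a b \<beta>)
    then show ?thesis
      by (auto simp: wrap_in_mid_even_comps inj_image_mem_iff[OF inj_wrap])
  qed (auto simp: mid_even_comps_def)
qed

abbreviation pair_sum :: "nat \<times> nat \<Rightarrow> nat" where
  "pair_sum \<equiv> (\<lambda>(a, b). a + b)"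

lemma finite_grading_pair_sum: "finite_grading pair_sum A"
proof -
  have "finite_grading (\<lambda>(a, b). a + b) (Sigma (UNIV :: nat set) (\<lambda>_. UNIV :: nat set))"
    by (rule finite_grading_Sigma) (auto intro: finite_grading_nat)
  then show ?thesis
    by (rule finite_grading_subset) simp
qed

lemma counting_gf_wrap:
  assumes "finite_grading sum_list B"
  shows "counting_gf sum_list (wrap ` (A \<times> B)) = counting_gf pair_sum A * counting_gf sum_list B"
proof -
  have "(\<lambda>x. sum_list (wrap x)) = (\<lambda>(p, \<beta>). pair_sum p + sum_list \<beta>)"
    by (auto simp: wrap_def)
  moreover have "(\<lambda>x :: (nat \<times> nat) \<times> nat list. 1 :: int) = (\<lambda>(p, \<beta>). 1 * 1)"
    by auto
  ultimately show ?thesis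
    using gf_mult[OF finite_grading_pair_sum assms, of "\<lambda>_. 1" A "\<lambda>_. 1"]
    by (simp add: gf_image[OF inj_wrap])
qed

definition even_series :: "int fps" where
  "even_series = Abs_fps (\<lambda>n. if even n then 1 else 0)"

lemma even_series_mult: "even_series * (1 - fps_X ^ 2) = 1"
proof (rule fps_ext)
  fix n
  show "(even_series * (1 - fps_X ^ 2)) $ n = 1 $ n"
    by (auto simp: even_series_def algebra_simps fps_X_power_mult_nth fps_X_power_mult_right_nth)
qed

lemma gf_short_comps: "counting_gf sum_list short_comps = even_series"
proof (rule fps_ext)
  fix n
  have "{\<alpha> \<in> short_comps. sum_list \<alpha> = n} = (if even n then {if n = 0 then [] else [n]} else {})"
    (is "_ = ?R")
  proof (rule set_eqI)
    fix \<alpha>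
    show "\<alpha> \<in> {\<alpha> \<in> short_comps. sum_list \<alpha> = n} \<longleftrightarrow> \<alpha> \<in> ?R"
    proof (cases \<alpha> rule: list_wrap_cases)
      case (3 a b \<beta>)
      then show ?thesis by (auto simp: short_comps_def wrap_def)
    qed (auto simp: short_comps_def mid_even_comps_def)
  qed
  then show "counting_gf sum_list short_comps $ n = even_series $ n"
    by (simp add: counting_gf_nth even_series_def)
qed

lemma gf_equal_pairs: "counting_gf pair_sum equal_pairs = fps_X ^ 2 * even_series"
proof (rule fps_ext)
  fix n
  have "{p \<in> equal_pairs. pair_sum p = n} = (if even n \<and> n \<ge> 2 then {(n div 2, n div 2)} else {})"
    by (auto simp: equal_pairs_def)
  then show "counting_gf pair_sum equal_pairs $ n = (fps_X ^ 2 * even_series) $ n"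
    by (auto simp: counting_gf_nth even_series_def fps_X_power_mult_nth)
qed

lemma gf_positive: "counting_gf (\<lambda>a. a) {1..} = fps_X * neg_binomial_series 0"
proof (rule fps_ext)
  fix n :: nat
  have "{a \<in> {1..}. a = n} = (if n = 0 then {} else {n})"
    by auto
  then show "counting_gf (\<lambda>a. a) {1..} $ n = (fps_X * neg_binomial_series 0) $ n"
    by (simp add: counting_gf_nth)
qed

text \<open>
  Unequal pairs are reached by complement: all pairs of positive integers form a product set.
\<close>
lemma gf_all_pairs:
  "counting_gf pair_sum equal_pairs + counting_gf pair_sum unequal_pairs
     = (fps_X * neg_binomial_series 0) ^ 2"
proof -
  have "counting_gf pair_sum equal_pairs + counting_gf pair_sum unequal_pairs
      = counting_gf pair_sum (equal_pairs \<union> unequal_pairs)"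
    by (rule gf_Un[symmetric])
      (auto intro: finite_grading_pair_sum simp: equal_pairs_def unequal_pairs_def)
  also have "equal_pairs \<union> unequal_pairs = {1..} \<times> {1..}"
    by (auto simp: equal_pairs_def unequal_pairs_def)
  also have "counting_gf pair_sum \<dots> = counting_gf (\<lambda>a. a) {1..} * counting_gf (\<lambda>a. a) {1..}"
    by (subst gf_mult) (auto intro: finite_grading_nat simp: case_prod_unfold)
  finally show ?thesis
    by (simp only: gf_positive power2_eq_square)
qed

lemma gf_rec_0:
  "counting_gf sum_list (mid_even_comps 0) * (1 - counting_gf pair_sum unequal_pairs) = even_series"
proof -
  have "counting_gf sum_list (mid_even_comps 0) = counting_gf sum_list short_comps
      + counting_gf sum_list (wrap ` (unequal_pairs \<times> mid_even_comps 0))"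
  proof (subst mid_even_comps_0, rule gf_Un)
    have sub: "short_comps \<subseteq> mid_even_comps 0"
        "wrap ` (unequal_pairs \<times> mid_even_comps 0) \<subseteq> mid_even_comps 0"
      using mid_even_comps_0 by blast+
    from sub show "finite_grading sum_list short_comps"
        "finite_grading sum_list (wrap ` (unequal_pairs \<times> mid_even_comps 0))"
      by (auto intro: finite_grading_subset[OF finite_grading_mid_even_comps])
    show "short_comps \<inter> wrap ` (unequal_pairs \<times> mid_even_comps 0) = {}"
      by (auto simp: short_comps_def)
  qed
  then show ?thesis
    by (simp add: counting_gf_wrap finite_grading_mid_even_comps gf_short_comps algebra_simps)
qed

lemma gf_rec_Suc:
  "counting_gf sum_list (mid_even_comps (Suc k)) * (1 - counting_gf pair_sum unequal_pairs)
     = counting_gf pair_sum equal_pairs * counting_gf sum_list (mid_even_comps k)"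
proof -
  let ?E = "wrap ` (equal_pairs \<times> mid_even_comps k)"
  let ?U = "wrap ` (unequal_pairs \<times> mid_even_comps (Suc k))"
  have "counting_gf sum_list (mid_even_comps (Suc k))
      = counting_gf sum_list ?E + counting_gf sum_list ?U"
  proof (subst mid_even_comps_Suc, rule gf_Un)
    have sub: "?E \<subseteq> mid_even_comps (Suc k)" "?U \<subseteq> mid_even_comps (Suc k)"
      using mid_even_comps_Suc by blast+
    from sub show "finite_grading sum_list ?E" "finite_grading sum_list ?U"
      by (auto intro: finite_grading_subset[OF finite_grading_mid_even_comps])
    show "?E \<inter> ?U = {}"
      by (auto simp: equal_pairs_def unequal_pairs_def dest!: inj_onD[OF inj_wrap[of UNIV]])
  qed
  then show ?thesis
    by (simp add: counting_gf_wrap finite_grading_mid_even_comps algebra_simps)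
qed

section \<open>Closed forms\<close>

text \<open>
  The series $Y$ and $T$ of the introduction, in the nested form in which \<open>fps_compose_eq_gf\<close> and
  \<open>linear_power_compose\<close> expand them.
\<close>
abbreviation (input) block_series :: "int fps" where
  "block_series \<equiv> fps_X ^ 2 * (1 + fps_X * (2 * neg_binomial_series 0))"

abbreviation (input) tribonacci_series :: "int fps" where
  "tribonacci_series \<equiv> fps_X ^ 1 * (1 + fps_X * (1 + fps_X))"

text \<open>
  With $Z = 1/(1-X)$ we have $(1 - X^2) Z^2 = (1 + X) Z = 1 + 2 X Z$, while
  $(1 - X^2) E = X^2$ for the equal pairs.
\<close>
lemma unequal_pairs_denominator:
  "(1 - fps_X ^ 2) * (1 - counting_gf pair_sum unequal_pairs) = 1 - block_series"
proof -
  let ?X = "fps_X :: int fps" and ?Z = "neg_binomial_series 0"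
  let ?U = "counting_gf pair_sum unequal_pairs"
  have ZX: "?Z = 1 + ?X * ?Z"
    using neg_binomial_series_0_mult by (simp add: algebra_simps)
  have EX: "even_series * (1 - ?X ^ 2) = 1" by (rule even_series_mult)
  have U: "?U = ?X ^ 2 * ?Z ^ 2 - ?X ^ 2 * even_series"
    using gf_all_pairs by (simp add: gf_equal_pairs power_mult_distrib algebra_simps)
  have "(1 - ?X ^ 2) * ?Z ^ 2 = (1 + ?X) * ?Z * (?Z * (1 - ?X))"
    by (simp add: algebra_simps power2_eq_square)
  also have "\<dots> = ?Z + ?X * ?Z"
    unfolding neg_binomial_series_0_mult by (simp add: algebra_simps)
  also have "\<dots> = 1 + 2 * (?X * ?Z)"
    by (subst ZX) (simp add: algebra_simps)
  finally have Z2: "(1 - ?X ^ 2) * ?Z ^ 2 = 1 + 2 * (?X * ?Z)" .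
  have "(1 - ?X ^ 2) * (1 - ?U) = (1 - ?X ^ 2) - ?X ^ 2 * ((1 - ?X ^ 2) * ?Z ^ 2)
      + ?X ^ 2 * (even_series * (1 - ?X ^ 2))"
    unfolding U by (simp add: algebra_simps)
  also have "\<dots> = 1 - block_series"
    unfolding EX Z2 by (simp add: algebra_simps)
  finally show ?thesis .
qed

text \<open>
  Each step of the recursion in $k$ costs one factor $1 - Y = (1 - X^2)(1 - U)$: $1 - U$ accounts for
  the unequal outer pairs, and $1 - X^2$ clears the denominator of the equal pairs, or that of
  the short compositions when $k = 0$.
\<close>
lemma gf_comps_mult: "counting_gf sum_list (mid_even_comps k) * (1 - block_series) ^ Suc k = fps_X ^ (2 * k)"
proof (induction k)
  case 0
  let ?P = "counting_gf sum_list (mid_even_comps 0)"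
  have "?P * (1 - block_series) = (?P * (1 - counting_gf pair_sum unequal_pairs)) * (1 - fps_X ^ 2)"
    unfolding unequal_pairs_denominator[symmetric] by (simp only: mult_ac)
  also have "\<dots> = 1"
    by (simp only: gf_rec_0 even_series_mult)
  finally show ?case
    by simp
next
  case (Suc k)
  let ?P = "\<lambda>k. counting_gf sum_list (mid_even_comps k)"
  let ?U = "counting_gf pair_sum unequal_pairs"
  have "?P (Suc k) * (1 - block_series) = (?P (Suc k) * (1 - ?U)) * (1 - fps_X ^ 2)"
    unfolding unequal_pairs_denominator[symmetric] by (simp only: mult_ac)
  also have "\<dots> = fps_X ^ 2 * (even_series * (1 - fps_X ^ 2)) * ?P k"
    unfolding gf_rec_Suc gf_equal_pairs by (simp only: mult_ac)
  finally have step: "?P (Suc k) * (1 - block_series) = fps_X ^ 2 * ?P k"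
    by (simp add: even_series_mult)
  have "?P (Suc k) * (1 - block_series) ^ Suc (Suc k) = (?P (Suc k) * (1 - block_series)) * (1 - block_series) ^ Suc k"
    by (simp only: power_Suc mult_ac)
  also have "\<dots> = fps_X ^ 2 * (?P k * (1 - block_series) ^ Suc k)"
    unfolding step by (simp only: mult_ac)
  also have "\<dots> = fps_X ^ (2 * Suc k)"
    unfolding Suc.IH by (simp add: power_add[symmetric])
  finally show ?case .
qed

lemma gf_comps_closed:
  "counting_gf sum_list (mid_even_comps k) = fps_X ^ (2 * k) * (neg_binomial_series k oo block_series)"
proof -
  let ?P = "counting_gf sum_list (mid_even_comps k)" and ?N = "neg_binomial_series k oo block_series"
  have N: "?N * (1 - block_series) ^ Suc k = 1"
    by (rule neg_binomial_series_compose) simp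
  have "?P = ?P * (?N * (1 - block_series) ^ Suc k)"
    by (simp only: N mult_1_right)
  also have "\<dots> = (?P * (1 - block_series) ^ Suc k) * ?N"
    by (simp only: mult_ac)
  finally show ?thesis
    by (simp only: gf_comps_mult)
qed

text \<open>
  Both sides become the same after multiplication by a power of $1 - Y$, because
  $(1 - X)(1 - Y) = 1 - X - X^2 - X^3$.
\<close>
lemma two_closed_forms:
  "neg_binomial_series k oo block_series = (1 - fps_X) ^ Suc k * (neg_binomial_series k oo tribonacci_series)"
proof -
  let ?NY = "neg_binomial_series k oo block_series" and ?NT = "neg_binomial_series k oo tribonacci_series"
  have NY: "?NY * (1 - block_series) ^ Suc k = 1"
    by (rule neg_binomial_series_compose) simp
  have NT: "?NT * (1 - tribonacci_series) ^ Suc k = 1"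
    by (rule neg_binomial_series_compose) simp
  have "(1 - fps_X) * block_series = fps_X ^ 2 * (1 - fps_X + 2 * fps_X * (neg_binomial_series 0 * (1 - fps_X)))"
    by (simp add: algebra_simps)
  also have "\<dots> = fps_X ^ 2 * (1 + fps_X)"
    unfolding neg_binomial_series_0_mult by (simp add: algebra_simps)
  finally have "1 - tribonacci_series = (1 - fps_X) * (1 - block_series)"
    by (simp add: algebra_simps power2_eq_square)
  then have denominators: "(1 - tribonacci_series) ^ Suc k = (1 - fps_X) ^ Suc k * (1 - block_series) ^ Suc k"
    by (simp only: power_mult_distrib)
  have "?NY = ?NY * (?NT * (1 - tribonacci_series) ^ Suc k)"
    by (simp only: NT mult_1_right)
  also have "\<dots> = (1 - fps_X) ^ Suc k * ?NT * (?NY * (1 - block_series) ^ Suc k)"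
    unfolding denominators by (simp only: mult_ac)
  finally show ?thesis
    by (simp only: NY mult_1_right)
qed

lemma finite_grading_UNIV_prod:
  assumes "\<And>i::nat. i \<le> w i" "\<And>i. finite_grading (v i) UNIV"
  shows "finite_grading (\<lambda>(i, y). w i + v i y) UNIV"
  using finite_grading_Sigma[of w UNIV v "\<lambda>_. UNIV"] assms by (simp add: finite_grading_nat)

lemma first_expansion:
  "neg_binomial_series k oo block_series = gf
     (\<lambda>(r, i, j). 2 ^ i * ibinom (int r + int k) (int k) * ibinom (int r) (int i)
        * ibinom (int i + int j - 1) (int j))
     (\<lambda>(r, i, j). 2 * r + (i + j)) UNIV"
proof -
  let ?Z = "neg_binomial_series 0"
  have Z: "(2 * ?Z) ^ i = gf (\<lambda>j. 2 ^ i * ibinom (int i + int j - 1) (int j)) (\<lambda>j. j) UNIV" for i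
  proof -
    have "(2 * ?Z) ^ i $ j = 2 ^ i * ibinom (int i + int j - 1) (int j)" for j
      by (simp add: power_mult_distrib geometric_power_nth[symmetric] numeral_fps_const
          fps_const_power)
    then show ?thesis
      using fps_eq_gf_nat[of "(2 * ?Z) ^ i"] by (simp only:)
  qed
  have T: "(1 + fps_X * (2 * ?Z)) ^ r = gf
      (\<lambda>(i, j). int (r choose i) * (2 ^ i * ibinom (int i + int j - 1) (int j))) (\<lambda>(i, j). i + j) UNIV"
    for r
    by (rule linear_power_compose[OF Z]) (simp add: finite_grading_nat)
  have "neg_binomial_series k oo block_series = gf
      (\<lambda>(r, p). neg_binomial_series k $ r
        * (case p of (i, j) \<Rightarrow> int (r choose i) * (2 ^ i * ibinom (int i + int j - 1) (int j))))
      (\<lambda>(r, p). 2 * r + (case p of (i, j) \<Rightarrow> i + j)) UNIV"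
    by (rule fps_compose_eq_gf[OF _ T]) (simp_all add: finite_grading_UNIV_prod finite_grading_nat)
  also have "\<dots> = gf
     (\<lambda>(r, i, j). 2 ^ i * ibinom (int r + int k) (int k) * ibinom (int r) (int i)
        * ibinom (int i + int j - 1) (int j))
     (\<lambda>(r, i, j). 2 * r + (i + j)) UNIV"
    by (rule arg_cong2[where f = "\<lambda>c w. gf c w UNIV"])
      (auto simp: fun_eq_iff ibinom_of_nat of_nat_add[symmetric] simp del: of_nat_add)
  finally show ?thesis .
qed

text \<open>
  Expanding $1 + X (1 + X)$ twice gives indices $t$ and $s$ with weight $t + s$. Here $s$ counts the
  factors that contribute $X^2$ and $t$ those that contribute more than $1$, so that $r = t - s$
  is the number of factors contributing $X$.
\<close>
lemma trinomial_power:
  "(1 + fps_X * (1 + fps_X)) ^ j = gf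
     (\<lambda>(r, s). ibinom (int j) (int r + int s) * ibinom (int r + int s) (int r))
     (\<lambda>(r, s). r + 2 * s) UNIV"
proof -
  have Q: "(1 + fps_X) ^ t = gf (\<lambda>s. int (t choose s)) (\<lambda>s. s) UNIV" for t
    using fps_eq_gf_nat[of "(1 + fps_X) ^ t"] linear_power_nth[of 1 t] by simp
  have "(1 + fps_X * (1 + fps_X)) ^ j
      = gf (\<lambda>(t, s). int (j choose t) * int (t choose s)) (\<lambda>(t, s). t + s) UNIV"
    by (rule linear_power_compose[OF Q]) (simp add: finite_grading_nat)
  also have "\<dots> = gf
     (\<lambda>(r, s). ibinom (int j) (int r + int s) * ibinom (int r + int s) (int r))
     (\<lambda>(r, s). r + 2 * s) UNIV"
  proof -
    let ?f = "\<lambda>(r, s). (r + s, s) :: nat \<times> nat"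
    have inj: "inj ?f"
      by (auto simp: inj_on_def)
    have range: "(t, s) \<in> range ?f" if "s \<le> t" for t s
      using that by (auto intro!: image_eqI[of _ _ "(t - s, s)"])
    (* The index pairs (t, s) missed by the substitution t = r + s are those with s > t. *)
    have zero: "int (j choose t) * int (t choose s) = 0" if "(t, s) \<notin> range ?f" for t s
    proof -
      have "t < s"
        using that range[of s t] by (cases "s \<le> t") auto
      then show ?thesis by simp
    qed
    have "gf (\<lambda>(t, s). int (j choose t) * int (t choose s)) (\<lambda>(t, s). t + s) UNIV
        = gf (\<lambda>(t, s). int (j choose t) * int (t choose s)) (\<lambda>(t, s). t + s) (range ?f)"
      by (rule gf_mono_neutral[OF finite_grading_pair_sum]) (use zero in \<open>auto simp del: mult_eq_0_iff\<close>)
    also have "\<dots> = gf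
     (\<lambda>(r, s). ibinom (int j) (int r + int s) * ibinom (int r + int s) (int r))
     (\<lambda>(r, s). r + 2 * s) UNIV"
      unfolding gf_image[OF inj]
    proof (rule arg_cong2[where f = "\<lambda>c w. gf c w UNIV"])
      have "int ((r + s) choose s) = ibinom (int r + int s) (int r)" for r s
        using ibinom_of_nat[of "r + s" r] binomial_symmetric[of r "r + s"] by simp
      moreover have "int (j choose (r + s)) = ibinom (int j) (int r + int s)" for r s
        using ibinom_of_nat[of j "r + s"] by simp
      ultimately show "(\<lambda>x. case ?f x of (t, s) \<Rightarrow> int (j choose t) * int (t choose s))
          = (\<lambda>(r, s). ibinom (int j) (int r + int s) * ibinom (int r + int s) (int r))"
        by (simp add: fun_eq_iff)
    qed (auto simp: fun_eq_iff)
    finally show ?thesis .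
  qed
  finally show ?thesis .
qed

lemma second_expansion:
  "(1 - fps_X) ^ Suc k * (neg_binomial_series k oo tribonacci_series) = gf
     (\<lambda>(i, j, r, s). (- 1) ^ i * ibinom (int k + 1) (int i) * ibinom (int j + int k) (int j)
        * ibinom (int j) (int r + int s) * ibinom (int r + int s) (int r))
     (\<lambda>(i, j, r, s). i + (j + (r + 2 * s))) UNIV"
proof -
  let ?d = "\<lambda>j (r, s). ibinom (int j) (int r + int s) * ibinom (int r + int s) (int r)"
  let ?v = "\<lambda>(r, s). r + 2 * s :: nat"
  have fin: "finite_grading ?v UNIV"
    by (rule finite_grading_UNIV_prod) (simp_all add: finite_grading_nat)
  have N: "neg_binomial_series k oo tribonacci_series
      = gf (\<lambda>(j, p). neg_binomial_series k $ j * ?d j p) (\<lambda>(j, p). 1 * j + ?v p) UNIV"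
    by (rule fps_compose_eq_gf[OF _ trinomial_power]) (simp_all add: fin)
  have L: "(1 - fps_X) ^ Suc k = gf (\<lambda>i. (- 1) ^ i * int (Suc k choose i)) (\<lambda>i. i) UNIV"
    using fps_eq_gf_nat[of "(1 - fps_X) ^ Suc k"] linear_power_nth[of "- 1" "Suc k"]
    by (simp add: fps_const_neg[symmetric] del: fps_const_neg power_Suc binomial_Suc_Suc)
  have "(1 - fps_X) ^ Suc k * (neg_binomial_series k oo tribonacci_series)
      = gf (\<lambda>(i, q). (- 1) ^ i * int (Suc k choose i)
             * (case q of (j, p) \<Rightarrow> neg_binomial_series k $ j * ?d j p))
           (\<lambda>(i, q). i + (case q of (j, p) \<Rightarrow> 1 * j + ?v p)) (UNIV \<times> UNIV)"
    unfolding N L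
    by (rule gf_mult) (simp_all add: finite_grading_nat finite_grading_UNIV_prod[OF _ fin])
  also have "\<dots> = gf
     (\<lambda>(i, j, r, s). (- 1) ^ i * ibinom (int k + 1) (int i) * ibinom (int j + int k) (int j)
        * ibinom (int j) (int r + int s) * ibinom (int r + int s) (int r))
     (\<lambda>(i, j, r, s). i + (j + (r + 2 * s))) UNIV"
  proof -
    have upper: "ibinom (int k + 1) (int i) = int (Suc k choose i)" for i
      using ibinom_of_nat[of "Suc k" i] by (simp add: add.commute)
    have lower: "ibinom (int j + int k) (int j) = int ((j + k) choose k)" for j
      using ibinom_of_nat[of "j + k" j] binomial_symmetric[of k "j + k"] by simp
    show ?thesis
      unfolding UNIV_Times_UNIV
      by (rule arg_cong2[where f = "\<lambda>c w. gf c w UNIV"])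
        (simp_all add: fun_eq_iff upper lower del: binomial_Suc_Suc)
  qed
  finally show ?thesis .
qed

theorem theorem2p3:
  fixes n k :: nat
  shows "int (ac_plus k n)
           = (\<Sum>(r, i, j) \<in> {(r::nat, i::nat, j::nat). 2 * int r + int i + int j = int n - 2 * int k}.
                2 ^ i * ibinom (int r + int k) (int k) * ibinom (int r) (int i)
                  * ibinom (int i + int j - 1) (int j))
       \<and> (\<Sum>(r, i, j) \<in> {(r::nat, i::nat, j::nat). 2 * int r + int i + int j = int n - 2 * int k}.
                2 ^ i * ibinom (int r + int k) (int k) * ibinom (int r) (int i)
                  * ibinom (int i + int j - 1) (int j))
           = (\<Sum>(i, j, r, s) \<in> {(i::nat, j::nat, r::nat, s::nat).
                    int i + int j + int r + 2 * int s = int n - 2 * int k}.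
                (- 1) ^ i * ibinom (int k + 1) (int i) * ibinom (int j + int k) (int j)
                  * ibinom (int j) (int r + int s) * ibinom (int r + int s) (int r))"
proof -
  let ?F = "neg_binomial_series k oo block_series"
  have ac: "int (ac_plus k n) = (if n < 2 * k then 0 else ?F $ (n - 2 * k))"
    by (simp add: ac_plus_eq_nth gf_comps_closed fps_X_power_mult_nth)
  show ?thesis
  proof (cases "n < 2 * k")
    case True
    (* The required total n - 2k is a negative integer, so no indices are admitted. *)
    then have "{(r::nat, i::nat, j::nat). 2 * int r + int i + int j = int n - 2 * int k} = {}"
      "{(i::nat, j::nat, r::nat, s::nat).
          int i + int j + int r + 2 * int s = int n - 2 * int k} = {}"
      by auto
    with ac True show ?thesis
      by (simp only: sum.empty if_True)
  next
    case False
    then have A: "{(r::nat, i::nat, j::nat). 2 * int r + int i + int j = int n - 2 * int k}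
        = {x. x \<in> UNIV \<and> (case x of (r, i, j) \<Rightarrow> 2 * r + (i + j)) = n - 2 * k}"
      and B: "{(i::nat, j::nat, r::nat, s::nat).
          int i + int j + int r + 2 * int s = int n - 2 * int k}
        = {x. x \<in> UNIV \<and> (case x of (i, j, r, s) \<Rightarrow> i + (j + (r + 2 * s))) = n - 2 * k}"
      by auto
    have "int (ac_plus k n) = ?F $ (n - 2 * k)"
      using ac False by simp
    then show ?thesis
      unfolding A B gf_nth[symmetric] first_expansion[symmetric] second_expansion[symmetric]
      by (simp only: two_closed_forms[symmetric] simp_thms)
  qed
qed

end
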